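(* Let $k\in\mathbb N$ with $k\ge 3$ and let $D$ be an oriented graph with minimum pseudo-semidegree $\bar\delta^0(D)\ge (3k-2)/4$. Then $D$ contains each antidirected path of length $k$ (as a subgraph).
   Context: All digraphs are finite. A digraph has directed edges, at most one for each direction between each pair of distinct vertices (no loops); $uv$ denotes an edge from $u$ to $v$. An oriented graph is a digraph in which for each pair of vertices $u,v$ at most one of the edges $uv$, $vu$ is present. $d^-(v)$ and $d^+(v)$ denote the in-degree and out-degree of $v$. The minimum pseudo-semidegree $\bar\delta^0(D)$ of a digraph $D$ is $0$ if $D$ has no edges; otherwise it is the maximum $d\in\mathbb N$ such that each vertex of $D$ has out-degree either $0$ or at least $d$, and in-degree either $0$ or at least $d$ (equivalently, the minimum of all nonzero in-degrees and all nonzero out-degrees of vertices of $D$). An antidirected path (antipath) is an orientation of a path in which every vertex has, within the path, either out-degree $0$ or in-degree $0$; that is, edge directions alternate along the path. Its length is its number of edges. Up to isomorphism there is exactly one antidirected path of length $k$ if $k$ is odd, and there are exactly two if $k$ is even $\ge 2$ (both end-edges directed away from the endvertices, or both directed towards the endvertices); "each antidirected path of length $k$" means all of these. *)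

theory Defs
  imports Complex_Main "Graph_Theory.Graph_Theory"
begin

definition oriented_graph :: "('a, 'b) pre_digraph \<Rightarrow> bool" where
  "oriented_graph D \<longleftrightarrow>
    digraph D \<and> (\<forall>u v. \<not> (u \<rightarrow>\<^bsub>D\<^esub> v \<and> v \<rightarrow>\<^bsub>D\<^esub> u))"

definition min_pseudo_semidegree :: "('a, 'b) pre_digraph \<Rightarrow> nat" where
  "min_pseudo_semidegree D =
    (if arcs D = {} then 0
     else GREATEST d. \<forall>v\<in>verts D.
       (out_degree D v = 0 \<or> d \<le> out_degree D v) \<and>
       (in_degree D v = 0 \<or> d \<le> in_degree D v))"

text \<open>On finite digraphs the maximum is attained, so \<^const>\<open>Greatest\<close> is meaningful.\<close>

lemma (in fin_digraph) le_min_pseudo_semidegree_iff: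
  assumes "arcs G \<noteq> {}"
  shows "d \<le> min_pseudo_semidegree G \<longleftrightarrow>
    (\<forall>v\<in>verts G. (out_degree G v = 0 \<or> d \<le> out_degree G v) \<and>
                  (in_degree G v = 0 \<or> d \<le> in_degree G v))"
proof -
  define P where "P d \<longleftrightarrow> (\<forall>v\<in>verts G. (out_degree G v = 0 \<or> d \<le> out_degree G v) \<and>
                  (in_degree G v = 0 \<or> d \<le> in_degree G v))" for d
  from assms obtain e where e: "e \<in> arcs G" by blast
  then have "e \<in> out_arcs G (tail G e)" by simp
  then have "out_degree G (tail G e) \<noteq> 0"
    by (metis card_0_eq empty_iff finite_out_arcs out_degree_def)
  then have bound: "y \<le> out_degree G (tail G e)" if "P y" for y
    using that bspec[OF that[unfolded P_def] tail_in_verts[OF e]] by simp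
  have eq: "min_pseudo_semidegree G = (GREATEST d. P d)"
    using assms by (simp add: min_pseudo_semidegree_def P_def)
  have "P 0" by (simp add: P_def)
  then have "P (GREATEST d. P d)" using bound by (rule GreatestI_nat)
  moreover have "d \<le> (GREATEST d. P d)" if "P d"
    using that bound by (rule Greatest_le_nat)
  moreover have "P d" if "d \<le> m" "P m" for m
    using that unfolding P_def by (meson le_trans)
  ultimately show ?thesis unfolding eq P_def[symmetric] by blast
qed

text \<open>
  \<open>P\<close> is an orientation of the path \<open>p ! 0, p ! 1, \<dots>, p ! k\<close>, whose length is its
  number \<open>k\<close> of edges; the directions of the edges are arbitrary.
\<close>

definition oriented_path :: "nat \<Rightarrow> ('a, 'b) pre_digraph \<Rightarrow> bool" where
  "oriented_path k P \<longleftrightarrow>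
    oriented_graph P \<and>
    (\<exists>p. distinct p \<and> length p = Suc k \<and> verts P = set p \<and>
      (\<forall>u v. u \<rightarrow>\<^bsub>P\<^esub> v \<or> v \<rightarrow>\<^bsub>P\<^esub> u \<longleftrightarrow>
        (\<exists>i<k. {u, v} = {p ! i, p ! Suc i})))"

definition antidirected_path :: "nat \<Rightarrow> ('a, 'b) pre_digraph \<Rightarrow> bool" where
  "antidirected_path k P \<longleftrightarrow>
    oriented_path k P \<and> (\<forall>v\<in>verts P. out_degree P v = 0 \<or> in_degree P v = 0)"

text \<open>Not necessarily induced containment, up to isomorphism.\<close>

definition contains_digraph :: "('a, 'b) pre_digraph \<Rightarrow> ('c, 'd) pre_digraph \<Rightarrow> bool" where
  "contains_digraph D P \<longleftrightarrow> (\<exists>H. subgraph H D \<and> digraph_iso P H)"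

end

theory Submission
  imports Defs
begin

text \<open>
  It suffices to extend an antipath \<open>p\<close> with \<open>m\<close> edges, whose first vertex is a sink of \<open>p\<close>, by an
  in-neighbour of a first vertex; reversing all arcs exchanges the two kinds of antipaths.
  Let \<open>B\<close> and \<open>A\<close> be the sinks and sources of \<open>p\<close>, and let \<open>X \<subseteq> B\<close> be the set of first vertices of
  antipaths with the same sinks and sources. If no extension exists, all in-neighbours of
  \<open>x \<in> X\<close> lie in \<open>A \<union> B\<close>, and reversing initial segments (Posa rotation) shows that at most \<open>|X|\<close>
  of them lie in \<open>A\<close> (fewer than \<open>|X|\<close> if \<open>m\<close> is even). As \<open>D\<close> is oriented, some \<open>x \<in> X\<close> has at most
  \<open>(|X| - 1) / 2\<close> in-neighbours in \<open>X\<close>. Comparing with the degree bound gives a contradiction for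
  even \<open>m\<close>, while for odd \<open>m\<close> it forces \<open>X = B\<close>. Averaging the in-degrees over \<open>B\<close> then shows that all
  arcs from \<open>A\<close> to \<open>B\<close> are present. In this extremal case choose an arc \<open>u \<rightarrow> v\<close> inside \<open>B\<close>, an
  out-neighbour \<open>y\<close> of \<open>u\<close> outside \<open>A \<union> B\<close>, and an in-neighbour \<open>z\<close> of \<open>y\<close> outside \<open>B\<close>; then
  \<open>z \<rightarrow> y \<leftarrow> u \<rightarrow> v\<close> continues, alternating between \<open>A - {z}\<close> and \<open>B - {u, v}\<close>, to an antipath
  with \<open>m + 1\<close> edges.
\<close>

section \<open>Antipaths as vertex lists, their sinks and sources\<close>

text \<open>The first vertex is a sink; antipaths starting with a source are those of \<open>E\<inverse>\<inverse>\<close>.\<close>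

definition antipath :: "('a \<Rightarrow> 'a \<Rightarrow> bool) \<Rightarrow> 'a list \<Rightarrow> bool" where
  "antipath E p \<longleftrightarrow> distinct p \<and>
    (\<forall>i. Suc i < length p \<longrightarrow> (if even i then E (p ! Suc i) (p ! i) else E (p ! i) (p ! Suc i)))"

text \<open>In an antipath of \<open>E\<close> with at least two vertices, \<open>evens\<close>
  collects the sinks and \<open>odds\<close> the sources.\<close>

definition evens :: "'a list \<Rightarrow> 'a set" where
  "evens p = (!) p ` {i. i < length p \<and> even i}"

definition odds :: "'a list \<Rightarrow> 'a set" where
  "odds p = (!) p ` {i. i < length p \<and> odd i}"

lemma evens_Un_odds: "evens p \<union> odds p = set p"
  by (auto simp: evens_def odds_def set_conv_nth)

lemma evens_Int_odds: "distinct p \<Longrightarrow> evens p \<inter> odds p = {}"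
  by (auto simp: evens_def odds_def nth_eq_iff_index_eq)

lemma finite_evens: "finite (evens p)" and finite_odds: "finite (odds p)"
  by (simp_all add: evens_def odds_def)

lemma card_even_less: "card {i. i < n \<and> even i} = (n + 1) div 2"
proof -
  have "{i. i < n \<and> even i} = (\<lambda>j. 2 * j) ` {..<(n + 1) div 2}"
    by (auto elim!: evenE)
  then show ?thesis by (simp add: card_image inj_on_def)
qed

lemma card_odd_less: "card {i. i < n \<and> odd i} = n div 2"
proof -
  have "{i. i < n \<and> odd i} = (\<lambda>j. 2 * j + 1) ` {..<n div 2}"
    by (auto elim!: oddE)
  then show ?thesis by (simp add: card_image inj_on_def)
qed

lemma card_evens: "distinct p \<Longrightarrow> card (evens p) = (length p + 1) div 2"
  unfolding evens_def by (subst card_image) (auto simp: card_even_less inj_on_nth)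

lemma card_odds: "distinct p \<Longrightarrow> card (odds p) = length p div 2"
  unfolding odds_def by (subst card_image) (auto simp: card_odd_less inj_on_nth)

lemma antipath_Nil [simp]: "antipath E []"
  by (simp add: antipath_def)

text \<open>Prepending a vertex flips the parity of every position, so the tail is an antipath of
  the converse relation.\<close>

lemma antipath_Cons:
  "antipath E (x # p) \<longleftrightarrow> x \<notin> set p \<and> (p \<noteq> [] \<longrightarrow> E (p ! 0) x) \<and> antipath E\<inverse>\<inverse> p"
proof -
  define Q where "Q i \<longleftrightarrow>
    (if even i then E ((x # p) ! Suc i) ((x # p) ! i) else E ((x # p) ! i) ((x # p) ! Suc i))" for i
  have "(\<forall>i. Suc i < length (x # p) \<longrightarrow> Q i) \<longleftrightarrow>
      (p \<noteq> [] \<longrightarrow> Q 0) \<and> (\<forall>i. Suc i < length p \<longrightarrow> Q (Suc i))"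
    by auto (metis not0_implies_Suc)
  moreover have "antipath E (x # p) \<longleftrightarrow>
      x \<notin> set p \<and> distinct p \<and> (\<forall>i. Suc i < length (x # p) \<longrightarrow> Q i)"
    by (simp add: antipath_def Q_def)
  moreover have "antipath E\<inverse>\<inverse> p \<longleftrightarrow> distinct p \<and> (\<forall>i. Suc i < length p \<longrightarrow> Q (Suc i))"
    by (auto simp: antipath_def Q_def)
  ultimately show ?thesis
    by (auto simp: Q_def)
qed

section \<open>Reversal and Posa rotation\<close>

text \<open>With an odd number of vertices the last one is a sink like the first; with an even
  number it is a source, hence the converse.\<close>

lemma antipath_rev:
  assumes "antipath E p"
  shows "antipath (if odd (length p) then E else E\<inverse>\<inverse>) (rev p)"
proof -
  have "if even i then E (rev p ! Suc i) (rev p ! i) else E (rev p ! i) (rev p ! Suc i)"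
    if "odd (length p)" "Suc i < length p" for i
  proof -
    define j where "j = length p - Suc (Suc i)"
    have "rev p ! i = p ! Suc j" "rev p ! Suc i = p ! j" "Suc j < length p"
      using that by (simp_all add: j_def rev_nth Suc_diff_Suc)
    moreover have "even j \<longleftrightarrow> odd i" using that by (auto simp: j_def)
    ultimately show ?thesis using assms by (auto simp: antipath_def)
  qed
  moreover have "if odd i then E (rev p ! Suc i) (rev p ! i) else E (rev p ! i) (rev p ! Suc i)"
    if "even (length p)" "Suc i < length p" for i
  proof -
    define j where "j = length p - Suc (Suc i)"
    have "rev p ! i = p ! Suc j" "rev p ! Suc i = p ! j" "Suc j < length p"
      using that by (simp_all add: j_def rev_nth Suc_diff_Suc)
    moreover have "even j \<longleftrightarrow> even i" using that by (auto simp: j_def)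
    ultimately show ?thesis using assms by (auto simp: antipath_def)
  qed
  ultimately show ?thesis using assms by (auto simp: antipath_def)
qed

lemma nth_rotate_prefix:
  assumes "i < length p" "j < length p"
  shows "(rev (take i p) @ drop i p) ! j = p ! (if j < i then i - Suc j else j)"
  using assms by (auto simp: nth_append rev_nth)

text \<open>The arc from \<open>p ! i\<close> to \<open>p ! 0\<close> replaces the one from
  \<open>p ! i\<close> to \<open>p ! (i - 1)\<close>, and \<open>p ! (i - 1)\<close> becomes the
  first vertex. As \<open>i - 1\<close> is even, reversing the positions from \<open>0\<close> to
  \<open>i - 1\<close> preserves parity.\<close>

lemma rotate_prefix:
  assumes p: "antipath E p" and i: "i < length p" "odd i" and E: "E (p ! i) (p ! 0)"
  shows "antipath E (rev (take i p) @ drop i p)" (is "antipath E ?q")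
    and "evens (rev (take i p) @ drop i p) = evens p"
    and "odds (rev (take i p) @ drop i p) = odds p"
proof -
  define s where "s j = (if j < i then i - Suc j else j)" for j
  have len: "length ?q = length p" using i by simp
  have nth: "?q ! j = p ! s j" if "j < length p" for j
    using nth_rotate_prefix[OF i(1) that] by (simp add: s_def)
  have s: "s j < length p" "even (s j) \<longleftrightarrow> even j" "s (s j) = j" if "j < length p" for j
    using that i by (auto simp: s_def)
  have "distinct (rev (take i p) @ drop i p)"
    using p by (simp add: antipath_def set_take_disj_set_drop_if_distinct)
  moreover have "if even j then E (?q ! Suc j) (?q ! j) else E (?q ! j) (?q ! Suc j)"
    if j: "Suc j < length p" for j
  proof -
    have step: "if even l then E (p ! Suc l) (p ! l) else E (p ! l) (p ! Suc l)"
      if "Suc l < length p" for l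
      using p that by (simp add: antipath_def)
    consider "Suc j < i" | "Suc j = i" | "i \<le> j" by linarith
    then show ?thesis
    proof cases
      case 1
      then have "Suc (s (Suc j)) = s j" "even (s (Suc j)) \<longleftrightarrow> odd j"
        using i by (auto simp: s_def)
      then show ?thesis using step[of "s (Suc j)"] nth[of j] nth[of "Suc j"] j s(1)[of j]
        by (auto split: if_splits)
    next
      case 2
      then show ?thesis using nth[of j] nth[of "Suc j"] j i E by (auto simp: s_def)
    next
      case 3
      then show ?thesis using step[of j] nth[of j] nth[of "Suc j"] j by (auto simp: s_def)
    qed
  qed
  ultimately show "antipath E ?q" using len by (simp add: antipath_def)
  have im: "s ` {j. j < length p \<and> even j} = {j. j < length p \<and> even j}"
    "s ` {j. j < length p \<and> odd j} = {j. j < length p \<and> odd j}"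
    using s by (auto intro!: image_eqI[of _ s "s _"])
  have "evens ?q = (\<lambda>j. p ! s j) ` {j. j < length p \<and> even j}"
    unfolding evens_def len by (rule image_cong) (auto simp: nth)
  also have "\<dots> = evens p" unfolding evens_def by (metis im(1) image_image)
  finally show "evens ?q = evens p" .
  have "odds ?q = (\<lambda>j. p ! s j) ` {j. j < length p \<and> odd j}"
    unfolding odds_def len by (rule image_cong) (auto simp: nth)
  also have "\<dots> = odds p" unfolding odds_def by (metis im(2) image_image)
  finally show "odds ?q = odds p" .
qed

text \<open>With an odd number of vertices, position \<open>j\<close> is reflected to
  \<open>length p - 1 - j\<close>, of the same parity. One inclusion suffices because
  \<open>rev\<close> is an involution.\<close>

lemma evens_rev:
  assumes "odd (length p)" shows "evens (rev p) = evens p" "odds (rev p) = odds p"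
proof -
  have *: "evens (rev p) \<subseteq> evens p \<and> odds (rev p) \<subseteq> odds p" if "odd (length p)" for p :: "'a list"
  proof (intro conjI subsetI)
    fix x assume "x \<in> evens (rev p)"
    then obtain j where j: "j < length p" "even j" "x = rev p ! j" by (auto simp: evens_def)
    then show "x \<in> evens p" using that
      unfolding evens_def by (intro image_eqI[of _ _ "length p - Suc j"]) (auto simp: rev_nth)
  next
    fix x assume "x \<in> odds (rev p)"
    then obtain j where j: "j < length p" "odd j" "x = rev p ! j" by (auto simp: odds_def)
    then show "x \<in> odds p" using that
      unfolding odds_def by (intro image_eqI[of _ _ "length p - Suc j"]) (auto simp: rev_nth)
  qed
  show "evens (rev p) = evens p" "odds (rev p) = odds p"
    using *[of p] *[of "rev p"] assms by auto
qed

section \<open>Arc counts and complete bipartite pairs\<close>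

text \<open>Asymmetry makes \<open>R\<close> disjoint from its converse and from the diagonal, so
  both fit together into the ordered pairs of distinct elements of \<open>X\<close>.\<close>

lemma sum_indegree_le:
  assumes fin: "finite X" and asym: "\<And>u v. E u v \<Longrightarrow> \<not> E v u"
  shows "2 * (\<Sum>x\<in>X. card {y \<in> X. E y x}) \<le> card X * (card X - 1)"
proof -
  define R where "R = (SIGMA x:X. {y \<in> X. E y x})"
  have finR: "finite R" using fin by (simp add: R_def)
  have "2 * (\<Sum>x\<in>X. card {y \<in> X. E y x}) = card R + card (R\<inverse>)"
    using fin finR by (simp add: R_def)
  also have "\<dots> = card (R \<union> R\<inverse>)"
    by (rule card_Un_disjoint[symmetric]) (use finR asym in \<open>auto simp: R_def\<close>)
  also have "\<dots> \<le> card (X \<times> X - (\<lambda>x. (x, x)) ` X)"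
    by (rule card_mono) (use fin asym in \<open>auto simp: R_def\<close>)
  also have "\<dots> = card X * (card X - 1)"
    using fin by (subst card_Diff_subset)
      (auto simp: card_image inj_on_def card_cartesian_product diff_mult_distrib2)
  finally show ?thesis .
qed

text \<open>Averaging: the mean in-degree inside \<open>X\<close> is at most
  \<open>(card X - 1) / 2\<close>.\<close>

lemma ex_small_indegree:
  assumes "finite X" "X \<noteq> {}" and asym: "\<And>u v. E u v \<Longrightarrow> \<not> E v u"
  obtains x where "x \<in> X" "2 * card {y \<in> X. E y x} + 1 \<le> card X"
proof (rule ccontr)
  assume "\<not> thesis"
  with that have "card X \<le> 2 * card {y \<in> X. E y x}" if "x \<in> X" for x
    using that by force
  then have "(\<Sum>x\<in>X. card X) \<le> 2 * (\<Sum>x\<in>X. card {y \<in> X. E y x})"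
    unfolding sum_distrib_left by (rule sum_mono)
  also have "\<dots> \<le> card X * (card X - 1)"
    using assms(1) asym by (rule sum_indegree_le)
  finally have "card X * card X \<le> card X * (card X - 1)" by simp
  moreover have "card X > 0" using assms by (simp add: card_gt_0_iff)
  ultimately show False by simp
qed

text \<open>With all arcs from \<open>A\<close> to \<open>B\<close> present, any alternating order
  works. The induction peels off \<open>b\<close> and some \<open>a\<close>; for
  \<open>n = 1\<close> no vertex of \<open>B\<close> remains to continue from.\<close>

lemma antipath_interleave:
  assumes "finite A" "finite B" "A \<inter> B = {}" "card A = n" "card B = n" "b \<in> B"
    and "\<And>x y. x \<in> A \<Longrightarrow> y \<in> B \<Longrightarrow> E x y"
  obtains p where "antipath E p" "set p = A \<union> B" "length p = 2 * n" "p ! 0 = b"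
proof -
  have "\<exists>p. antipath E p \<and> set p = A \<union> B \<and> length p = 2 * n \<and> p ! 0 = b"
    using assms
  proof (induction n arbitrary: A B b)
    case 0
    then show ?case by simp
  next
    case (Suc n)
    then obtain a where a: "a \<in> A" by fastforce
    show ?case
    proof (cases "n = 0")
      case True
      then have "A = {a}" "B = {b}"
        using Suc.prems a by (auto simp: card_Suc_eq)
      then show ?thesis
        using Suc.prems True by (intro exI[of _ "[b, a]"]) (auto simp: antipath_Cons)
    next
      case False
      have cards: "card (A - {a}) = n" "card (B - {b}) = n"
        using Suc.prems a by auto
      with False obtain b' where b': "b' \<in> B - {b}" by (metis card.empty equals0I)
      have "\<exists>p. antipath E p \<and> set p = (A - {a}) \<union> (B - {b}) \<and> length p = 2 * n \<and> p ! 0 = b'"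
        by (rule Suc.IH) (use Suc.prems cards b' in auto)
      then obtain p where p: "antipath E p" "set p = (A - {a}) \<union> (B - {b})" "length p = 2 * n"
        "p ! 0 = b'" by blast
      have "E a b" "E a b'" "a \<noteq> b" "a \<notin> B" "b \<notin> A" using Suc.prems a b' by auto
      then show ?thesis using p a Suc.prems(6)
        by (intro exI[of _ "b # a # p"]) (auto simp: antipath_Cons)
    qed
  qed
  with that show thesis by blast
qed

section \<open>Extending an antipath by one vertex\<close>

text \<open>The bounds are attached to arcs: \<open>E u v\<close> makes the in-degree of
  \<open>v\<close> and the out-degree of \<open>u\<close> nonzero, and only nonzero degrees are
  bounded by the pseudo-semidegree.\<close>

locale antipath_host =
  fixes E :: "'a \<Rightarrow> 'a \<Rightarrow> bool" and d :: nat
  assumes asym: "E u v \<Longrightarrow> \<not> E v u"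
    and two_le_d: "2 \<le> d"
    and indegree: "E u v \<Longrightarrow> d \<le> card {w. E w v}"
    and outdegree: "E u v \<Longrightarrow> d \<le> card {w. E u w}"
begin

lemma dual: "antipath_host E\<inverse>\<inverse> d"
  by unfold_locales (use asym two_le_d indegree outdegree in auto)

text \<open>\<open>length p\<close> counts vertices, so it is the number of edges of the new
  antipath and plays the part of \<open>k\<close> in the degree bound. A new vertex in front is a
  source, hence the converse in the conclusion.\<close>

lemma extend:
  assumes p: "antipath E p" and len: "length p \<ge> 2" and d: "3 * length p \<le> 4 * d + 2"
  obtains q where "antipath E\<inverse>\<inverse> q" "length q = Suc (length p)"
proof (rule ccontr)
  assume "\<not> thesis"
  with that have max: "\<not> antipath E\<inverse>\<inverse> q" if "length q = Suc (length p)" for q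
    using that by blast
  define A where "A = odds p"
  define B where "B = evens p"
  define Q where "Q = {q. antipath E q \<and> length q = length p \<and> evens q = B \<and> odds q = A}"
  define X where "X = (\<lambda>q. q ! 0) ` Q"
  define N where "N x = {w. E w x}" for x
  have dist: "distinct p" using p by (simp add: antipath_def)
  have cardA: "card A = length p div 2" and cardB: "card B = (length p + 1) div 2"
    using dist by (simp_all add: A_def B_def card_odds card_evens)
  have finA: "finite A" and finB: "finite B"
    by (simp_all add: A_def B_def finite_odds finite_evens)
  have disj: "A \<inter> B = {}" using evens_Int_odds[OF dist] by (auto simp: A_def B_def)
  have "p \<in> Q" using p by (simp add: Q_def A_def B_def)
  then have "X \<noteq> {}" by (auto simp: X_def)
  have "X \<subseteq> B"
    using len by (force simp: X_def Q_def evens_def)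
  then have finX: "finite X" using finB by (rule finite_subset)
  have N_sub: "N x \<subseteq> A \<union> B" if x: "x \<in> X" for x
  proof
    fix w assume w: "w \<in> N x"
    obtain q where q: "q \<in> Q" "x = q ! 0" using x by (auto simp: X_def)
    then have q': "antipath E q" "length q = length p" "set q = A \<union> B" "q \<noteq> []"
      using len evens_Un_odds[of q] by (auto simp: Q_def)
    show "w \<in> A \<union> B"
    proof (rule ccontr)
      assume "w \<notin> A \<union> B"
      then have "antipath E\<inverse>\<inverse> (w # q)"
        using q q' w by (simp add: antipath_Cons N_def)
      with max[of "w # q"] q'(2) show False by simp
    qed
  qed
  \<comment> \<open>Each in-neighbour \<open>q ! i\<close> of \<open>x\<close> in \<open>A\<close>
    yields by rotation its own member \<open>q ! (i - 1)\<close> of \<open>X\<close>.\<close>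
  have N_A: "card (N x \<inter> A) + (if odd (length p) then 1 else 0) \<le> card X" if x: "x \<in> X" for x
  proof -
    obtain q where q: "q \<in> Q" "x = q ! 0" using x by (auto simp: X_def)
    then have q': "antipath E q" "length q = length p" "evens q = B" "odds q = A" "distinct q"
      by (auto simp: Q_def antipath_def)
    define I where "I = {i. i < length q \<and> odd i \<and> E (q ! i) x}"
    have pred: "q ! (i - 1) \<in> X" if "i \<in> I" for i
    proof -
      have i: "i < length q" "odd i" "E (q ! i) (q ! 0)" using that q by (auto simp: I_def)
      have "rev (take i q) @ drop i q \<in> Q"
        using rotate_prefix[OF q'(1) i] q' i by (simp add: Q_def)
      moreover have "(rev (take i q) @ drop i q) ! 0 = q ! (i - 1)"
        using nth_rotate_prefix[of i q 0] i by (cases "q = []") (auto simp: odd_pos)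
      ultimately show ?thesis unfolding X_def by force
    qed
    have "N x \<inter> A = (!) q ` I"
      by (auto simp: N_def I_def odds_def simp flip: q'(4))
    then have "card (N x \<inter> A) = card I"
      using q'(5) by (simp add: card_image I_def inj_on_nth)
    also have "\<dots> = card ((\<lambda>i. q ! (i - 1)) ` I)"
      by (rule card_image[symmetric])
        (use q'(5) in \<open>auto simp: I_def inj_on_def nth_eq_iff_index_eq elim!: oddE\<close>)
    finally have card: "card (N x \<inter> A) = card ((\<lambda>i. q ! (i - 1)) ` I)" .
    show ?thesis
    proof (cases "odd (length p)")
      case True
      \<comment> \<open>The last vertex of \<open>q\<close> is one more member of \<open>X\<close>:
        it starts \<open>rev q\<close>, and it is no \<open>q ! (i - 1)\<close> with
        \<open>i < length q\<close>.\<close>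
      define z where "z = q ! (length q - 1)"
      have "rev q \<in> Q"
        using antipath_rev[OF q'(1)] evens_rev[of q] q' True by (simp add: Q_def)
      moreover have "0 < length q" using q'(2) len by linarith
      ultimately have "z \<in> X" unfolding X_def z_def
        by (intro image_eqI[of _ _ "rev q"]) (simp_all add: rev_nth)
      moreover have "z \<notin> (\<lambda>i. q ! (i - 1)) ` I"
        using q' by (auto simp: z_def I_def nth_eq_iff_index_eq elim!: oddE)
      ultimately have "card (insert z ((\<lambda>i. q ! (i - 1)) ` I)) \<le> card X"
        using pred by (intro card_mono finX) auto
      with \<open>z \<notin> _\<close> True card show ?thesis by (simp add: I_def)
    next
      case False
      then show ?thesis using card pred by (auto intro!: card_mono finX)
    qed
  qed
  \<comment> \<open>The in-neighbour \<open>q ! 1\<close> makes the in-degree of \<open>x\<close>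
    nonzero, so the bound applies.\<close>
  have d_le: "d \<le> card (N x)" if x: "x \<in> X" for x
  proof -
    obtain q where q: "q \<in> Q" "x = q ! 0" using x by (auto simp: X_def)
    then have "E (q ! 1) x" using len by (auto simp: Q_def antipath_def)
    then show ?thesis unfolding N_def by (rule indegree)
  qed
  obtain x where x: "x \<in> X" "2 * card {y \<in> X. E y x} + 1 \<le> card X"
    using ex_small_indegree[where E = E, OF finX \<open>X \<noteq> {}\<close> asym] by blast
  have "N x \<subseteq> (N x \<inter> A) \<union> {y \<in> X. E y x} \<union> (B - X)"
    using N_sub[OF x(1)] by (auto simp: N_def)
  then have "card (N x) \<le> card ((N x \<inter> A) \<union> {y \<in> X. E y x} \<union> (B - X))"
    by (rule card_mono[rotated]) (use finA finB finX in auto)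
  also have "\<dots> \<le> card (N x \<inter> A) + card {y \<in> X. E y x} + card (B - X)"
    by (meson add_le_mono card_Un_le le_refl le_trans)
  finally have "d \<le> card (N x \<inter> A) + card {y \<in> X. E y x} + (card B - card X)"
    using d_le[OF x(1)] card_Diff_subset[OF finX \<open>X \<subseteq> B\<close>] by linarith
  moreover have XB: "card X \<le> card B" by (rule card_mono) fact+
  ultimately have key: "2 * d + card X + 1 \<le> 2 * card (N x \<inter> A) + 2 * card B"
    using x(2) by linarith
  show False
  proof (cases "odd (length p)")
    case True
    \<comment> \<open>Here \<open>card B = r + 1\<close> and \<open>N_A\<close> gains one, so
      \<open>key\<close> yields \<open>2 * d \<le> 3 * r\<close>, against
      \<open>6 * r + 1 \<le> 4 * d\<close>.\<close>
    then obtain r where "length p = 2 * r + 1" by (elim oddE)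
    with key N_A[OF x(1)] True XB cardB d show False by simp
  next
    case False
    then obtain a where a: "length p = 2 * a" by (auto elim!: evenE)
    then have card_a: "card A = a" "card B = a" using cardA cardB by auto
    \<comment> \<open>\<open>key\<close> and \<open>N_A\<close> give
      \<open>card X \<ge> 2 * d + 1 - 2 * a\<close>, and
      \<open>2 * d \<ge> 3 * a - 1\<close>.\<close>
    have "a \<le> card X" using key N_A[OF x(1)] False a d card_a by simp
    then have XeqB: "X = B" using \<open>X \<subseteq> B\<close> finB card_a by (metis card_seteq)
    have ineq: "d \<le> card (N x \<inter> A) + card {y \<in> B. E y x}" if "x \<in> B" for x
    proof -
      have "N x = (N x \<inter> A) \<union> {y \<in> B. E y x}"
        using N_sub[of x] that XeqB by (auto simp: N_def)
      then have "card (N x) \<le> card (N x \<inter> A) + card {y \<in> B. E y x}"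
        by (metis card_Un_le)
      with d_le[of x] that XeqB show ?thesis by simp
    qed
    have NA_le: "card (N x \<inter> A) \<le> a" for x
      using card_mono[OF finA, of "N x \<inter> A"] card_a by simp
    have "1 \<le> a" using a len by simp
    \<comment> \<open>For \<open>a = 1\<close> this is \<open>2 \<le> d\<close>; for larger
      \<open>a\<close> it follows from the hypothesis \<open>d\<close>.\<close>
    have d_gt: "a + 1 \<le> d" using d a two_le_d by (cases "a = 1") auto
    \<comment> \<open>All in-degrees inside \<open>B\<close> are at least \<open>d - a\<close>, and
      a missing arc into \<open>v\<close> makes that of \<open>v\<close> larger. Their sum then
      exceeds \<open>a * (d - a)\<close>, but it is at most \<open>a * (a - 1) / 2\<close>, although
      \<open>2 * (d - a) \<ge> a - 1\<close>.\<close>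
    have complete: "E u v" if "u \<in> A" "v \<in> B" for u v
    proof (rule ccontr)
      assume "\<not> E u v"
      then have "N v \<inter> A \<subset> A" using that by (auto simp: N_def)
      then have "card (N v \<inter> A) < a" using psubset_card_mono[OF finA] card_a by simp
      then have strict: "d - a < card {y \<in> B. E y v}" using ineq[OF that(2)] d_gt by linarith
      have "(\<Sum>x\<in>B. d - a) < (\<Sum>x\<in>B. card {y \<in> B. E y x})"
      proof (rule sum_strict_mono_ex1[OF finB])
        show "\<forall>x\<in>B. d - a \<le> card {y \<in> B. E y x}"
        proof
          fix x assume "x \<in> B"
          from ineq[OF this] NA_le[of x] show "d - a \<le> card {y \<in> B. E y x}" by linarith
        qed
        show "\<exists>x\<in>B. d - a < card {y \<in> B. E y x}" using strict that by blast
      qed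
      then have "a * (d - a) < (\<Sum>x\<in>B. card {y \<in> B. E y x})" using card_a by simp
      moreover have "2 * (\<Sum>x\<in>B. card {y \<in> B. E y x}) \<le> a * (a - 1)"
        using sum_indegree_le[where E = E, OF finB asym] card_a by simp
      ultimately have "2 * (a * (d - a)) < a * (a - 1)" by linarith
      then have "a * (2 * (d - a)) < a * (a - 1)" by (simp only: mult.left_commute)
      then have "2 * (d - a) < a - 1" by simp
      with d a d_gt show False by linarith
    qed
    obtain v where "v \<in> B" using card_a \<open>1 \<le> a\<close> by fastforce
    with ineq[of v] NA_le[of v] d_gt have "card {y \<in> B. E y v} \<noteq> 0" by linarith
    then obtain u where u: "u \<in> B" "E u v" by (metis (mono_tags, lifting) card.empty empty_Collect_eq)
    have "u \<noteq> v" using u asym by blast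
    \<comment> \<open>As \<open>card B = a < d\<close>, neither the out-neighbours of
      \<open>u\<close> nor, below, the in-neighbours of \<open>y\<close> fit into
      \<open>B\<close>.\<close>
    have "\<not> {w. E u w} \<subseteq> B"
      using outdegree[OF u(2)] card_mono[OF finB, of "{w. E u w}"] card_a d_gt by linarith
    then obtain y where y: "E u y" "y \<notin> B" by blast
    then have "y \<notin> A" using complete[of y u] u asym by blast
    have "\<not> {w. E w y} \<subseteq> B"
      using indegree[OF y(1)] card_mono[OF finB, of "{w. E w y}"] card_a d_gt by linarith
    then obtain z where z: "E z y" "z \<notin> B" by blast
    have "z \<noteq> y" using z asym by blast
    \<comment> \<open>\<open>z\<close> may or may not lie in \<open>A\<close>; in both cases
      \<open>a - 1\<close> other vertices of \<open>A\<close> are available.\<close>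
    have "a - 1 \<le> card (A - {z})" using card_a finA by (simp add: card_Diff_singleton_if)
    then obtain A' where A': "A' \<subseteq> A - {z}" "card A' = a - 1"
      by (meson obtain_subset_with_card_n)
    have "finite A'" using A' finA finite_subset by fastforce
    obtain r where r: "antipath E r" "set r = A' \<union> (B - {u})" "length r = 2 * (a - 1)" "r ! 0 = v"
    proof (rule antipath_interleave[of A' "B - {u}" "a - 1" v E])
      show "card (B - {u}) = a - 1" using u card_a finB by simp
      show "E s t" if "s \<in> A'" "t \<in> B - {u}" for s t using that A' complete by blast
    qed (use A' \<open>finite A'\<close> finB disj \<open>v \<in> B\<close> \<open>u \<noteq> v\<close> in auto)
    \<comment> \<open>There are \<open>3 + 2 * (a - 1) = 2 * a + 1\<close> vertices, one more than
      in \<open>p\<close>, and the first one is a source.\<close>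
    have "antipath E\<inverse>\<inverse> (z # y # u # r)"
      using r z y u A' disj \<open>y \<notin> A\<close> \<open>z \<noteq> y\<close> by (auto simp: antipath_Cons)
    moreover have "length (z # y # u # r) = Suc (length p)" using r a \<open>1 \<le> a\<close> by simp
    ultimately show False using max by blast
  qed
qed

end

text \<open>Starting from a single arc, each use of \<open>extend\<close> swaps the relation with
  its converse, so the inner claim is generalised over \<open>E\<close>.\<close>

lemma (in antipath_host) ex_antipath:
  assumes "E u v" "1 \<le> k" "3 * k \<le> 4 * d + 2"
  shows "\<exists>p. antipath E p \<and> length p = Suc k"
proof -
  have "\<exists>p. antipath E p \<and> length p = Suc k"
    if "antipath_host E d" "\<exists>u v. E u v" "1 \<le> k" "3 * k \<le> 4 * d + 2" for k and E :: "'a \<Rightarrow> 'a \<Rightarrow> bool"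
    using that(3,4,1,2)
  proof (induction k arbitrary: E rule: dec_induct)
    case base
    then obtain u v where "E u v" by blast
    moreover have "u \<noteq> v" using antipath_host.asym[OF base(2) \<open>E u v\<close>] \<open>E u v\<close> by blast
    ultimately show ?case by (intro exI[of _ "[v, u]"]) (auto simp: antipath_Cons)
  next
    case (step k)
    interpret E': antipath_host "E\<inverse>\<inverse>" d using antipath_host.dual step.prems by blast
    have "\<exists>u v. E\<inverse>\<inverse> u v" using step.prems by auto
    moreover have "3 * k \<le> 4 * d + 2" using step.prems by simp
    ultimately obtain p where p: "antipath E\<inverse>\<inverse> p" "length p = Suc k"
      using step.IH E'.antipath_host_axioms by blast
    show ?case by (rule E'.extend[OF p(1)]) (use p step in auto)
  qed
  then show ?thesis using assms antipath_host_axioms by blast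
qed

section \<open>Transfer to digraphs and their subgraphs\<close>

lemma (in digraph) out_degree_eq_card: "out_degree G v = card {w. v \<rightarrow> w}"
proof -
  have "{w. v \<rightarrow> w} = head G ` out_arcs G v" by (auto simp: arcs_ends_conv)
  moreover have "inj_on (head G) (out_arcs G v)"
    by (auto simp: inj_on_def arc_to_ends_def intro: no_multi_arcs)
  ultimately show ?thesis by (simp add: out_degree_def card_image)
qed

lemma (in digraph) in_degree_eq_card: "in_degree G v = card {w. w \<rightarrow> v}"
proof -
  have "{w. w \<rightarrow> v} = tail G ` in_arcs G v" by (auto simp: arcs_ends_conv)
  moreover have "inj_on (tail G) (in_arcs G v)"
    by (auto simp: inj_on_def arc_to_ends_def intro: no_multi_arcs)
  ultimately show ?thesis by (simp add: in_degree_def card_image)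
qed

text \<open>A vertex map suffices: arcs of \<open>D\<close> are chosen for the images of arcs,
  injectively because \<open>P\<close> has no parallel arcs.\<close>

lemma contains_digraphI:
  assumes "digraph P" "wf_digraph D" "inj_on f (verts P)"
    and "f ` verts P \<subseteq> verts D"
    and hom: "\<And>u v. u \<rightarrow>\<^bsub>P\<^esub> v \<Longrightarrow> f u \<rightarrow>\<^bsub>D\<^esub> f v"
  shows "contains_digraph D P"
proof -
  interpret P: digraph P by fact
  interpret D: wf_digraph D by fact
  have "\<forall>e\<in>arcs P. \<exists>e'. e' \<in> arcs D \<and> tail D e' = f (tail P e) \<and> head D e' = f (head P e)"
  proof
    fix e assume "e \<in> arcs P"
    then have "tail P e \<rightarrow>\<^bsub>P\<^esub> head P e" by (auto simp: arcs_ends_conv)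
    from hom[OF this] show "\<exists>e'. e' \<in> arcs D \<and> tail D e' = f (tail P e) \<and> head D e' = f (head P e)"
      by (auto elim!: reachableE)
  qed
  from bchoice[OF this] obtain g where
    g: "g e \<in> arcs D" "tail D (g e) = f (tail P e)" "head D (g e) = f (head P e)"
    if "e \<in> arcs P" for e
    by blast
  define h where "h = \<lparr>iso_verts = f, iso_arcs = g, iso_head = head D, iso_tail = tail D\<rparr>"
  have "inj_on g (arcs P)"
  proof (rule inj_onI)
    fix e e' assume e: "e \<in> arcs P" "e' \<in> arcs P" "g e = g e'"
    then have "f (tail P e) = f (tail P e')" "f (head P e) = f (head P e')"
      using g[of e] g[of e'] by auto
    then have "arc_to_ends P e = arc_to_ends P e'"
      using e assms(3) by (auto simp: arc_to_ends_def dest: inj_onD)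
    with e show "e = e'" by (intro P.no_multi_arcs)
  qed
  then have iso: "P.digraph_isomorphism h"
    using assms(3) g P.wf_digraph_axioms by (simp add: P.digraph_isomorphism_def h_def)
  have "subgraph (app_iso h P) D"
  proof (rule subgraphI)
    show "wf_digraph (app_iso h P)" using iso by (rule P.wf_digraphI_app_iso)
    show "compatible D (app_iso h P)" by (simp add: compatible_def h_def)
  qed (use assms(4) g D.wf_digraph_axioms in \<open>auto simp: h_def\<close>)
  then show ?thesis using iso by (auto simp: contains_digraph_def digraph_iso_def)
qed

text \<open>The first arc fixes the pattern; as no vertex has both an incoming and an outgoing arc,
  the directions must then alternate.\<close>

lemma antipathI:
  assumes "distinct p"
    and link: "\<And>i. Suc i < length p \<Longrightarrow> E (p ! i) (p ! Suc i) \<or> E (p ! Suc i) (p ! i)"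
    and no_through: "\<And>u v w. E u v \<Longrightarrow> \<not> E v w"
    and start: "1 < length p \<Longrightarrow> E (p ! 1) (p ! 0)"
  shows "antipath E p"
proof -
  have "if even i then E (p ! Suc i) (p ! i) else E (p ! i) (p ! Suc i)"
    if "Suc i < length p" for i
    using that
  proof (induction i)
    case 0
    then show ?case using start by simp
  next
    case (Suc i)
    then show ?case using link[of "Suc i"] no_through by (auto split: if_splits)
  qed
  with assms(1) show ?thesis by (simp add: antipath_def)
qed

text \<open>Sending \<open>p ! i\<close> to \<open>q ! i\<close> works since both lists alternate in
  the same phase and \<open>orient\<close> leaves each edge of \<open>P\<close> a single direction.
  The two options for \<open>E\<close> and \<open>F\<close> cover a sink and a source as first
  vertex.\<close>

lemma contains_antipath:
  assumes "digraph P" "wf_digraph D" "verts P = set p"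
    and p: "antipath E p" and q: "antipath F q" and len: "length p = length q"
    and edges: "\<And>u v. u \<rightarrow>\<^bsub>P\<^esub> v \<Longrightarrow> \<exists>i. Suc i < length p \<and> {u, v} = {p ! i, p ! Suc i}"
    and orient: "\<And>u v. \<not> (u \<rightarrow>\<^bsub>P\<^esub> v \<and> v \<rightarrow>\<^bsub>P\<^esub> u)"
    and E: "E = dominates P \<and> F = dominates D \<or> E = (dominates P)\<inverse>\<inverse> \<and> F = (dominates D)\<inverse>\<inverse>"
    and sub: "set q \<subseteq> verts D"
  shows "contains_digraph D P"
proof -
  define f where "f v = q ! (THE i. i < length p \<and> p ! i = v)" for v
  have dist: "distinct p" "distinct q" using p q by (auto simp: antipath_def)
  have f: "f (p ! i) = q ! i" if "i < length p" for i
  proof -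
    have "(THE j. j < length p \<and> p ! j = p ! i) = i"
      using that dist by (intro the_equality) (auto simp: nth_eq_iff_index_eq)
    then show ?thesis by (simp add: f_def)
  qed
  show ?thesis
  proof (rule contains_digraphI)
    show "inj_on f (verts P)"
      using dist len by (auto simp: assms(3) inj_on_def in_set_conv_nth f nth_eq_iff_index_eq)
    show "f ` verts P \<subseteq> verts D"
    proof
      fix x assume "x \<in> f ` verts P"
      then obtain i where "i < length p" "x = f (p ! i)" by (auto simp: assms(3) in_set_conv_nth)
      then show "x \<in> verts D" using sub len f[of i] nth_mem[of i q] by auto
    qed
    fix u v assume uv: "u \<rightarrow>\<^bsub>P\<^esub> v"
    then obtain i where i: "Suc i < length p" "{u, v} = {p ! i, p ! Suc i}" using edges by blast
    have "if even i then E (p ! Suc i) (p ! i) else E (p ! i) (p ! Suc i)"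
      "if even i then F (q ! Suc i) (q ! i) else F (q ! i) (q ! Suc i)"
      using p q i len by (auto simp: antipath_def)
    moreover have "f (p ! i) = q ! i" "f (p ! Suc i) = q ! Suc i" using i f by auto
    moreover have "(u = p ! i \<and> v = p ! Suc i) \<or> (u = p ! Suc i \<and> v = p ! i)"
      using i(2) by (auto simp: doubleton_eq_iff)
    ultimately show "f u \<rightarrow>\<^bsub>D\<^esub> f v"
      using E uv orient by (auto split: if_splits)
  qed fact+
qed

theorem theorem2:
  fixes k :: nat and D :: "('a, 'b) pre_digraph" and P :: "('c, 'd) pre_digraph"
  assumes "3 \<le> k"
    and "oriented_graph D"
    and "real (min_pseudo_semidegree D) \<ge> (3 * real k - 2) / 4"
    and "antidirected_path k P"
  shows "contains_digraph D P"
proof -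
  interpret D: digraph D using assms(2) by (simp add: oriented_graph_def)
  have orP: "oriented_graph P" and antiP: "\<And>v. v \<in> verts P \<Longrightarrow> out_degree P v = 0 \<or> in_degree P v = 0"
    using assms(4) by (auto simp: antidirected_path_def oriented_path_def)
  interpret P: digraph P using orP by (simp add: oriented_graph_def)
  define d where "d = min_pseudo_semidegree D"
  have k: "3 * k \<le> 4 * d + 2" using assms(3) by (simp add: d_def field_simps)
  \<comment> \<open>\<open>k \<ge> 3\<close> makes \<open>d\<close> nonzero, which rules out the
    default value 0 of an arcless \<open>D\<close>.\<close>
  have "arcs D \<noteq> {}" using k assms(1) by (auto simp: d_def min_pseudo_semidegree_def)
  have deg: "(out_degree D v = 0 \<or> d \<le> out_degree D v) \<and> (in_degree D v = 0 \<or> d \<le> in_degree D v)"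
    if "v \<in> verts D" for v
    using D.le_min_pseudo_semidegree_iff[OF \<open>arcs D \<noteq> {}\<close>, of d] that by (auto simp: d_def)
  have fin: "finite {w. v \<rightarrow>\<^bsub>D\<^esub> w}" "finite {w. w \<rightarrow>\<^bsub>D\<^esub> v}" for v
    by (rule finite_subset[OF _ D.finite_verts]; auto dest: D.adj_in_verts)+
  interpret host: antipath_host "dominates D" d
  proof
    show "\<not> v \<rightarrow>\<^bsub>D\<^esub> u" if "u \<rightarrow>\<^bsub>D\<^esub> v" for u v
      using assms(2) that by (auto simp: oriented_graph_def)
    show "2 \<le> d" using k assms(1) by linarith
    show "d \<le> card {w. w \<rightarrow>\<^bsub>D\<^esub> v}" if "u \<rightarrow>\<^bsub>D\<^esub> v" for u v
      using deg[of v] that fin D.adj_in_verts[OF that] by (auto simp: D.in_degree_eq_card)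
    show "d \<le> card {w. u \<rightarrow>\<^bsub>D\<^esub> w}" if "u \<rightarrow>\<^bsub>D\<^esub> v" for u v
      using deg[of u] that fin D.adj_in_verts[OF that] by (auto simp: D.out_degree_eq_card)
  qed
  interpret host': antipath_host "(dominates D)\<inverse>\<inverse>" d by (rule host.dual)
  obtain p where p: "distinct p" "length p = Suc k" "verts P = set p"
    and adj: "\<And>u v. u \<rightarrow>\<^bsub>P\<^esub> v \<or> v \<rightarrow>\<^bsub>P\<^esub> u \<longleftrightarrow> (\<exists>i<k. {u, v} = {p ! i, p ! Suc i})"
    using assms(4) by (auto simp: antidirected_path_def oriented_path_def)
  have no_through: "\<not> v \<rightarrow>\<^bsub>P\<^esub> w" if "u \<rightarrow>\<^bsub>P\<^esub> v" for u v w
  proof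
    assume "v \<rightarrow>\<^bsub>P\<^esub> w"
    have "finite {w. v \<rightarrow>\<^bsub>P\<^esub> w}" "finite {w. w \<rightarrow>\<^bsub>P\<^esub> v}"
      by (rule finite_subset[OF _ P.finite_verts]; auto dest: P.adj_in_verts)+
    with antiP[of v] that \<open>v \<rightarrow>\<^bsub>P\<^esub> w\<close> show False
      using P.adj_in_verts[OF that] by (auto simp: P.in_degree_eq_card P.out_degree_eq_card)
  qed
  have link: "p ! i \<rightarrow>\<^bsub>P\<^esub> p ! Suc i \<or> p ! Suc i \<rightarrow>\<^bsub>P\<^esub> p ! i" if "Suc i < length p" for i
    using adj that p(2) by auto
  obtain e where "e \<in> arcs D" using \<open>arcs D \<noteq> {}\<close> by blast
  then have e: "tail D e \<rightarrow>\<^bsub>D\<^esub> head D e" by (auto simp: arcs_ends_conv)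
  have embed: "contains_digraph D P"
    if "antipath E p" "antipath F q" "length q = Suc k"
      "E = dominates P \<and> F = dominates D \<or> E = (dominates P)\<inverse>\<inverse> \<and> F = (dominates D)\<inverse>\<inverse>"
    for E F q
  proof (rule contains_antipath[OF P.digraph_axioms D.wf_digraph_axioms p(3) that(1,2) _ _ _ that(4)])
    show "length p = length q" using p that by simp
    show "\<exists>i. Suc i < length p \<and> {u, v} = {p ! i, p ! Suc i}" if "u \<rightarrow>\<^bsub>P\<^esub> v" for u v
      using adj[of u v] that p(2) by auto
    show "\<not> (u \<rightarrow>\<^bsub>P\<^esub> v \<and> v \<rightarrow>\<^bsub>P\<^esub> u)" for u v using orP by (auto simp: oriented_graph_def)
    show "set q \<subseteq> verts D"
    proof
      fix x assume "x \<in> set q"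
      then obtain i where i: "i < length q" "x = q ! i" by (auto simp: in_set_conv_nth)
      \<comment> \<open>An arc of \<open>q\<close> at position \<open>i\<close> is needed: the one
        before it, or for \<open>i = 0\<close> the one after it.\<close>
      define j where "j = (if i = 0 then 0 else i - 1)"
      have "Suc j < length q" "x = q ! j \<or> x = q ! Suc j"
        using i that(3) assms(1) by (auto simp: j_def)
      moreover from this(1) have "F (q ! j) (q ! Suc j) \<or> F (q ! Suc j) (q ! j)"
        using that(2) by (auto simp: antipath_def split: if_splits)
      ultimately show "x \<in> verts D" using that(4) D.adj_in_verts by auto
    qed
  qed
  \<comment> \<open>The first edge of \<open>P\<close> decides which alternating pattern
    \<open>P\<close> follows; the second pattern is found through the converse of
    \<open>D\<close>.\<close>
  show ?thesis
  proof (cases "p ! 1 \<rightarrow>\<^bsub>P\<^esub> p ! 0")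
    case True
    have "antipath (dominates P) p"
      by (rule antipathI) (use p(1) link no_through True in auto)
    moreover obtain q where "antipath (dominates D) q" "length q = Suc k"
      using host.ex_antipath[OF e _ k] assms(1) by auto
    ultimately show ?thesis using embed by blast
  next
    case False
    then have "p ! 0 \<rightarrow>\<^bsub>P\<^esub> p ! 1" using link[of 0] p(2) assms(1) by simp
    then have "antipath (dominates P)\<inverse>\<inverse> p"
      by (intro antipathI) (use p(1) link no_through in auto)
    moreover obtain q where "antipath (dominates D)\<inverse>\<inverse> q" "length q = Suc k"
      using host'.ex_antipath[of "head D e" "tail D e" k] e k assms(1) by auto
    ultimately show ?thesis using embed by blast
  qed
qed

end
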